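(* Any linear decision list computing $\mathsf{MAJ}_n\circ\mathsf{XOR}$ must have size $2^{\Omega(n)}$. That is, there exist a constant $c>0$ and an integer $n_0$ such that for every $n\ge n_0$, every linear decision list computing the function $\mathsf{MAJ}_n\circ\mathsf{XOR}:\{0,1\}^n\times\{0,1\}^n\to\{0,1\}$ has size at least $2^{cn}$.
   Context: Define $\mathrm{sign}:\mathbb{R}\to\{0,1\}$ by $\mathrm{sign}(x)=1$ if $x>0$ and $\mathrm{sign}(x)=0$ if $x\le 0$. A function $f:\{0,1\}^N\to\{0,1\}$ is a linear threshold function (LTF) if there are real numbers $w_0,w_1,\dots,w_N$ with $f(x)=\mathrm{sign}(w_0+\sum_{i=1}^N w_ix_i)$ for all $x$. A linear decision list of size $k$ on $N$ variables is a sequence $(L_1,a_1),\dots,(L_k,a_k)$ where each $a_i\in\{0,1\}$, each $L_i$ is an LTF on $\{0,1\}^N$ (arbitrary real weights), and $L_k$ is the constant function $1$. It computes the function $f$ given by $f(x)=a_i$, where $i$ is the least index with $L_i(x)=1$. $\mathsf{MAJ}_n:\{0,1\}^n\to\{0,1\}$ is $\mathsf{MAJ}_n(x)=\mathrm{sign}(x_1+\dots+x_n-n/2)$. For $f:\{0,1\}^n\to\{0,1\}$, $f\circ\mathsf{XOR}:\{0,1\}^n\times\{0,1\}^n\to\{0,1\}$ is $f\circ\mathsf{XOR}(x,y)=f(x_1\oplus y_1,\dots,x_n\oplus y_n)$, viewed as a function of $2n$ Boolean variables. *)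

theory Defs
  imports Complex_Main "HOL-Library.FuncSet"
begin

text \<open>
  The set \<open>{0,1}\<close> is \<^typ>\<open>bool\<close>. A point of \<open>{0,1}\<^sup>N\<close> is an extensional function on the
  coordinates \<open>{1..N}\<close>. A Boolean function on \<open>{0,1}\<^sup>N\<close> is a total function on
  \<^typ>\<open>nat \<Rightarrow> bool\<close> of which only the values on \<open>bool_cube N\<close> matter.
\<close>

definition bool_cube :: "nat \<Rightarrow> (nat \<Rightarrow> bool) set" where
  "bool_cube N = {1..N} \<rightarrow>\<^sub>E UNIV"

definition bsign :: "real \<Rightarrow> bool" where
  "bsign x \<longleftrightarrow> x > 0"

definition is_LTF :: "nat \<Rightarrow> ((nat \<Rightarrow> bool) \<Rightarrow> bool) \<Rightarrow> bool" where
  "is_LTF N f \<longleftrightarrow> (\<exists>(w0::real) (w::nat \<Rightarrow> real). \<forall>x\<in>bool_cube N.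
     f x = bsign (w0 + (\<Sum>i=1..N. w i * of_bool (x i))))"

text \<open>The size of a decision list is its \<^const>\<open>length\<close>.\<close>

type_synonym decision_list = "(((nat \<Rightarrow> bool) \<Rightarrow> bool) \<times> bool) list"

definition is_linear_decision_list :: "nat \<Rightarrow> decision_list \<Rightarrow> bool" where
  "is_linear_decision_list N D \<longleftrightarrow>
     D \<noteq> [] \<and>
     (\<forall>(L, a)\<in>set D. is_LTF N L) \<and>
     (\<forall>x\<in>bool_cube N. fst (last D) x)"

definition decision_list_value :: "decision_list \<Rightarrow> (nat \<Rightarrow> bool) \<Rightarrow> bool" where
  "decision_list_value D x = snd (D ! (LEAST i. i < length D \<and> fst (D ! i) x))"

definition decision_list_computes ::
    "nat \<Rightarrow> decision_list \<Rightarrow> ((nat \<Rightarrow> bool) \<Rightarrow> bool) \<Rightarrow> bool" where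
  "decision_list_computes N D f \<longleftrightarrow> (\<forall>x\<in>bool_cube N. decision_list_value D x = f x)"

definition MAJ :: "nat \<Rightarrow> (nat \<Rightarrow> bool) \<Rightarrow> bool" where
  "MAJ n x = bsign ((\<Sum>i=1..n. of_bool (x i)) - real n / 2)"

definition comp_XOR ::
    "nat \<Rightarrow> ((nat \<Rightarrow> bool) \<Rightarrow> bool) \<Rightarrow> (nat \<Rightarrow> bool) \<Rightarrow> (nat \<Rightarrow> bool) \<Rightarrow> bool" where
  "comp_XOR n f x y = f (\<lambda>i\<in>{1..n}. x i \<noteq> y i)"

text \<open>
  A function of two arguments in \<open>{0,1}\<^sup>n\<close> viewed as a function of \<open>2n\<close> variables:
  \<open>x\<close> occupies the coordinates \<open>1, \<dots>, n\<close> and \<open>y\<close> the coordinates \<open>n+1, \<dots>, 2n\<close>.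
\<close>

definition as_joint_function ::
    "nat \<Rightarrow> ((nat \<Rightarrow> bool) \<Rightarrow> (nat \<Rightarrow> bool) \<Rightarrow> bool) \<Rightarrow> (nat \<Rightarrow> bool) \<Rightarrow> bool" where
  "as_joint_function n F z = F (\<lambda>i\<in>{1..n}. z i) (\<lambda>i\<in>{1..n}. z (n + i))"

end

theory Submission
  imports Defs
begin

text \<open>
  An LTF in \<open>(x, y)\<close> has the form \<open>p x + q y > 0\<close>. Hence a linear decision list of size \<open>k\<close> admits a
  monochromatic rectangle whose sides have a fraction \<open>1/k\<close> of the cube: peel off the \<open>r\<close> points
  \<open>x\<close> with largest \<open>p x\<close> and the \<open>r\<close> points \<open>y\<close> with largest \<open>q y\<close>; either the LTF is constantly
  \<open>1\<close> on the product of the peeled parts, or it is constantly \<open>0\<close> on the product of the remainders,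
  where the tail of the list takes over.

  On the other hand, a rectangle that is monochromatic for majority of XOR is, after possibly
  complementing \<open>y\<close>, a pair of sets at Hamming distance at least \<open>n/2\<close>, and two such sets are
  exponentially small. This isoperimetric fact follows by tensorizing a two-point inequality for
  functions with \<open>f x * g y \<le> c * 4 ^ d(x, y)\<close>.
\<close>

section \<open>Distant sets in the cube\<close>

definition hamming_dist :: "'i set \<Rightarrow> ('i \<Rightarrow> bool) \<Rightarrow> ('i \<Rightarrow> bool) \<Rightarrow> nat" where
  "hamming_dist I x y = card {i\<in>I. x i \<noteq> y i}"

lemma hamming_dist_insert:
  assumes "finite I" "i \<notin> I"
  shows "hamming_dist (insert i I) (x(i := a)) (y(i := b)) = hamming_dist I x y + of_bool (a \<noteq> b)"
proof -
  have "{j \<in> insert i I. (x(i := a)) j \<noteq> (y(i := b)) j} =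
      (if a \<noteq> b then {i} else {}) \<union> {j\<in>I. x j \<noteq> y j}"
    using assms by auto
  then show ?thesis
    using assms by (simp add: hamming_dist_def)
qed

text \<open>\<open>P * Q\<close> is the product of the two diagonal terms, hence at most
  \<open>c * c\<close>. With \<open>P\<close> and \<open>Q\<close> at most \<open>4 * c\<close> this
  caps \<open>P + Q\<close> at \<open>4 * c + c / 4\<close>, and the diagonal adds
  \<open>2 * c\<close>. Bounding the four terms separately gives only \<open>10 * c\<close>, whereas
  the application needs a factor below 8.\<close>

lemma two_point_inequality:
  fixes f0 f1 g0 g1 c :: real
  assumes nonneg: "f0 \<ge> 0" "f1 \<ge> 0" "g0 \<ge> 0" "g1 \<ge> 0"
    and diag: "f0 * g0 \<le> c" "f1 * g1 \<le> c"
    and off: "f0 * g1 \<le> 4 * c" "f1 * g0 \<le> 4 * c"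
  shows "(f0 + f1) * (g0 + g1) \<le> 25/4 * c"
proof -
  define P Q where "P = f0 * g1" and "Q = f1 * g0"
  have c: "c \<ge> 0"
    using diag(1) nonneg by (meson mult_nonneg_nonneg order_trans)
  have PQ_nonneg: "P \<ge> 0" "Q \<ge> 0"
    using nonneg by (auto simp: P_def Q_def)
  have PQ_le: "P \<le> 4 * c" "Q \<le> 4 * c"
    using off by (auto simp: P_def Q_def)
  have PQ: "P * Q \<le> c * c"
    using mult_mono[OF diag c] nonneg by (simp add: P_def Q_def mult_ac)
  have "P + Q \<le> 17/4 * c"
  proof (cases "P \<le> c / 4")
    case True
    then show ?thesis using PQ_le by simp
  next
    case False
    then have "P > 0" using c by simp
    \<comment> \<open>The convex function \<open>P + c * c / P\<close> is largest at the ends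
      \<open>c / 4\<close> and \<open>4 * c\<close>, where it equals \<open>17/4 * c\<close>; here
      this is cleared of denominators.\<close>
    have "(4 * c - P) * (P - c / 4) \<ge> 0"
      using False PQ_le by simp
    then have "P * P + c * c \<le> P * (17/4 * c)"
      by (simp add: algebra_simps)
    then have "P * (P + Q) \<le> P * (17/4 * c)"
      using PQ by (simp add: algebra_simps)
    then show ?thesis using \<open>P > 0\<close> by simp
  qed
  moreover have "(f0 + f1) * (g0 + g1) = f0 * g0 + f1 * g1 + (P + Q)"
    by (simp add: P_def Q_def algebra_simps)
  ultimately show ?thesis using diag by simp
qed

lemma sum_PiE_insert_bool:
  fixes f :: "('i \<Rightarrow> bool) \<Rightarrow> 'a::comm_monoid_add"
  assumes "i \<notin> I"
  shows "(\<Sum>x\<in>insert i I \<rightarrow>\<^sub>E UNIV. f x) =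
    (\<Sum>x\<in>I \<rightarrow>\<^sub>E UNIV. f (x(i := False)) + f (x(i := True)))"
proof -
  have "(\<Sum>x\<in>insert i I \<rightarrow>\<^sub>E UNIV. f x) =
      (\<Sum>(b, x)\<in>UNIV \<times> (I \<rightarrow>\<^sub>E UNIV). f (x(i := b)))"
    unfolding PiE_insert_eq
    by (subst sum.reindex) (use inj_combinator[OF assms, of "\<lambda>_. UNIV"] in
      \<open>auto simp: case_prod_unfold intro!: sum.cong\<close>)
  also have "\<dots> = (\<Sum>b\<in>UNIV. \<Sum>x\<in>I \<rightarrow>\<^sub>E UNIV. f (x(i := b)))"
    by (simp add: sum.cartesian_product)
  finally show ?thesis
    by (simp add: UNIV_bool sum.distrib add.commute)
qed

text \<open>Summing out one coordinate gives functions on the smaller cube that satisfy the same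
  hypothesis with \<open>25/4 * c\<close> for \<open>c\<close>. Such sums of indicators need not be
  indicators, hence the form with nonnegative functions.\<close>

lemma sum_mult_sum_le_of_hamming_dist:
  fixes f g :: "('i \<Rightarrow> bool) \<Rightarrow> real"
  assumes "finite I"
    and "\<And>x. f x \<ge> 0" "\<And>x. g x \<ge> 0"
    and "\<And>x y. x \<in> I \<rightarrow>\<^sub>E UNIV \<Longrightarrow> y \<in> I \<rightarrow>\<^sub>E UNIV \<Longrightarrow> f x * g y \<le> c * 4 ^ hamming_dist I x y"
  shows "(\<Sum>x\<in>I \<rightarrow>\<^sub>E UNIV. f x) * (\<Sum>x\<in>I \<rightarrow>\<^sub>E UNIV. g x) \<le> c * (25/4) ^ card I"
  using assms
proof (induction I arbitrary: f g c rule: finite_induct)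
  case empty
  then show ?case by (simp add: hamming_dist_def)
next
  case (insert i I)
  let ?F = "\<lambda>x. f (x(i := False)) + f (x(i := True))"
  let ?G = "\<lambda>y. g (y(i := False)) + g (y(i := True))"
  have FG: "?F x * ?G y \<le> (25/4 * c) * 4 ^ hamming_dist I x y"
    if x: "x \<in> I \<rightarrow>\<^sub>E UNIV" and y: "y \<in> I \<rightarrow>\<^sub>E UNIV" for x y
  proof -
    have "f (x(i := a)) * g (y(i := b)) \<le>
        c * 4 ^ (hamming_dist I x y + of_bool (a \<noteq> b))" for a b
    proof -
      have "x(i := a) \<in> insert i I \<rightarrow>\<^sub>E UNIV" "y(i := b) \<in> insert i I \<rightarrow>\<^sub>E UNIV"
        using PiE_fun_upd[OF UNIV_I x] PiE_fun_upd[OF UNIV_I y] by auto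
      then show ?thesis
        using insert.prems(3) by (metis hamming_dist_insert[OF insert.hyps])
    qed
    \<comment> \<open>The two-point constant is \<open>c * 4 ^ hamming_dist I x y\<close>;
      disagreement at \<open>i\<close> supplies the factor 4 of the off-diagonal terms.\<close>
    from this[of False False] this[of True True] this[of False True] this[of True False]
    have "?F x * ?G y \<le> 25/4 * (c * 4 ^ hamming_dist I x y)"
      by (intro two_point_inequality insert.prems) (auto simp: mult_ac)
    then show ?thesis by (simp add: mult_ac)
  qed
  have "(\<Sum>x\<in>I \<rightarrow>\<^sub>E UNIV. ?F x) * (\<Sum>x\<in>I \<rightarrow>\<^sub>E UNIV. ?G x) \<le> (25/4 * c) * (25/4) ^ card I"
    by (intro insert.IH FG add_nonneg_nonneg insert.prems(1,2))
  then show ?case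
    using insert.hyps by (simp add: sum_PiE_insert_bool mult_ac)
qed

text \<open>Give the indicator of \<open>B\<close> the weight \<open>2 ^ card I\<close>: distance at
  least \<open>card I / 2\<close> bounds this weight by \<open>4 ^ hamming_dist I x y\<close>, so
  \<open>c = 1\<close> works. Dividing the weight out turns 25/4 into 25/8, which is below 4, so
  \<open>A\<close> and \<open>B\<close> cannot both be dense.\<close>

lemma card_mult_card_le_of_distant:
  fixes A B :: "('i \<Rightarrow> bool) set"
  assumes "finite I" "A \<subseteq> I \<rightarrow>\<^sub>E UNIV" "B \<subseteq> I \<rightarrow>\<^sub>E UNIV"
    and far: "\<And>x y. x \<in> A \<Longrightarrow> y \<in> B \<Longrightarrow> card I \<le> 2 * hamming_dist I x y"
  shows "real (card A) * real (card B) \<le> (25/8) ^ card I"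
proof -
  let ?f = "\<lambda>x. of_bool (x \<in> A) :: real"
  let ?g = "\<lambda>y. 2 ^ card I * of_bool (y \<in> B) :: real"
  have fin: "finite (I \<rightarrow>\<^sub>E (UNIV :: bool set))"
    using assms(1) by (intro finite_PiE) auto
  have sums: "(\<Sum>x\<in>I \<rightarrow>\<^sub>E UNIV. ?f x) = card A" "(\<Sum>x\<in>I \<rightarrow>\<^sub>E UNIV. ?g x) = 2 ^ card I * card B"
    using assms(2,3) fin
    by (simp_all add: Int_absorb1 Int_absorb2 flip: sum_distrib_left)
  have "?f x * ?g y \<le> 1 * 4 ^ hamming_dist I x y" for x y
  proof (cases "x \<in> A \<and> y \<in> B")
    case True
    then have "(2::real) ^ card I \<le> 2 ^ (2 * hamming_dist I x y)"
      using far by (intro power_increasing) auto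
    then show ?thesis using True by (simp add: power_mult)
  qed auto
  then have "(\<Sum>x\<in>I \<rightarrow>\<^sub>E UNIV. ?f x) * (\<Sum>x\<in>I \<rightarrow>\<^sub>E UNIV. ?g x) \<le> 1 * (25/4) ^ card I"
    by (intro sum_mult_sum_le_of_hamming_dist assms(1)) auto
  then have "2 ^ card I * (real (card A) * real (card B)) \<le> 2 ^ card I * (25/8) ^ card I"
    unfolding sums by (simp add: mult_ac flip: power_mult_distrib)
  then show ?thesis by simp
qed

section \<open>Monochromatic rectangles of linear decision lists\<close>

text \<open>Greedy choice: a maximum of the remainder joins \<open>S\<close>, and its value becomes
  the new threshold. Ties are broken arbitrarily, so both bounds are non-strict.\<close>

lemma ex_top_subset:
  fixes p :: "'a \<Rightarrow> 'b::linorder"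
  assumes "finite A" "r \<le> card A"
  shows "\<exists>S t. S \<subseteq> A \<and> card S = r \<and> (\<forall>x\<in>S. t \<le> p x) \<and> (\<forall>x\<in>A - S. p x \<le> t)"
  using assms(2)
proof (induction r)
  case 0
  \<comment> \<open>For empty \<open>A\<close> this \<open>Max\<close> is unspecified, but the claim
    is vacuous.\<close>
  have "\<forall>x\<in>A. p x \<le> Max (p ` A)"
    using assms(1) by simp
  then show ?case
    by (intro exI[of _ "{}"]) auto
next
  case (Suc r)
  then obtain S t where S: "S \<subseteq> A" "card S = r"
      and t: "\<forall>x\<in>S. t \<le> p x" "\<forall>x\<in>A - S. p x \<le> t"
    by auto
  have "A - S \<noteq> {}"
    using S Suc.prems by (metis Diff_eq_empty_iff Suc_n_not_le_n subset_antisym)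
  then obtain m where m: "m \<in> A - S" "\<forall>x\<in>A - S. p x \<le> p m"
    using assms(1) Max_in[of "p ` (A - S)"] Max_ge[of "p ` (A - S)"] by fastforce
  have "card (insert m S) = Suc r"
    using S m assms(1) finite_subset by fastforce
  then show ?case
    using S t m by (intro exI[of _ "insert m S"] exI[of _ "p m"]) force
qed

text \<open>Since the last entry fires at \<open>z\<close>, the \<open>LEAST\<close> ranges over a
  nonempty set, and removing a head that does not fire shifts it by one.\<close>

lemma decision_list_value_Cons:
  assumes "D \<noteq> []" "fst (last D) z"
  shows "decision_list_value ((L, a) # D) z = (if L z then a else decision_list_value D z)"
proof (cases "L z")
  case True
  then have "(LEAST i. i < length ((L, a) # D) \<and> fst (((L, a) # D) ! i) z) = 0"
    by (intro Least_equality) auto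
  then show ?thesis
    using True unfolding decision_list_value_def by simp
next
  case False
  let ?P = "\<lambda>i. i < length ((L, a) # D) \<and> fst (((L, a) # D) ! i) z"
  have "?P (length D)"
    using assms by (simp add: nth_Cons' last_conv_nth)
  moreover have "\<not> ?P 0"
    using False by simp
  ultimately have "(LEAST i. ?P i) = Suc (LEAST i. ?P (Suc i))"
    by (rule Least_Suc)
  then show ?thesis
    using False unfolding decision_list_value_def by simp
qed

text \<open>Each entry passed costs \<open>r\<close> points on either side, which the bounds
  \<open>length D * r\<close> pay for; the last entry keeps \<open>r\<close> points. The sides
  shrink along the list, so the induction generalizes over \<open>A\<close> and
  \<open>B\<close>.\<close>

lemma decision_list_monochromatic_rectangle:
  fixes J :: "'a \<Rightarrow> 'b \<Rightarrow> (nat \<Rightarrow> bool)"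
  assumes "D \<noteq> []" "finite A" "finite B"
    and "length D * r \<le> card A" "length D * r \<le> card B"
    and "\<And>L a. (L, a) \<in> set D \<Longrightarrow>
      \<exists>(p :: 'a \<Rightarrow> real) q. \<forall>x\<in>A. \<forall>y\<in>B. L (J x y) \<longleftrightarrow> p x + q y > 0"
    and "\<And>x y. x \<in> A \<Longrightarrow> y \<in> B \<Longrightarrow> fst (last D) (J x y)"
  shows "\<exists>A' B' v. A' \<subseteq> A \<and> B' \<subseteq> B \<and> card A' = r \<and> card B' = r \<and>
    (\<forall>x\<in>A'. \<forall>y\<in>B'. decision_list_value D (J x y) = v)"
  using assms
proof (induction D arbitrary: A B rule: list_nonempty_induct)
  case (single d)
  obtain A' where "A' \<subseteq> A" "card A' = r"
    using single.prems(3) obtain_subset_with_card_n[of r A] by auto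
  moreover obtain B' where "B' \<subseteq> B" "card B' = r"
    using single.prems(4) obtain_subset_with_card_n[of r B] by auto
  moreover have "decision_list_value [d] (J x y) = snd d" if "x \<in> A" "y \<in> B" for x y
  proof -
    have "(LEAST i. i < length [d] \<and> fst ([d] ! i) (J x y)) = 0"
      using single.prems(6)[OF that] by (intro Least_equality) auto
    then show ?thesis by (simp add: decision_list_value_def)
  qed
  ultimately show ?case
    by (intro exI[of _ A'] exI[of _ B'] exI[of _ "snd d"]) blast
next
  case (cons d D)
  obtain L a where d: "d = (L, a)" by force
  obtain p :: "'a \<Rightarrow> real" and q where pq: "\<forall>x\<in>A. \<forall>y\<in>B. L (J x y) \<longleftrightarrow> p x + q y > 0"
    using cons.prems(5)[of L a] d by auto
  have val: "decision_list_value (d # D) (J x y) =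
      (if L (J x y) then a else decision_list_value D (J x y))" if "x \<in> A" "y \<in> B" for x y
    using cons.prems(6)[OF that] cons.hyps unfolding d
    by (intro decision_list_value_Cons) auto
  have r: "r \<le> card A" "r \<le> card B"
    using cons.prems(3,4) by auto
  obtain S s where S: "S \<subseteq> A" "card S = r" "\<forall>x\<in>S. s \<le> p x" "\<forall>x\<in>A - S. p x \<le> s"
    using ex_top_subset[OF cons.prems(1) r(1)] by metis
  obtain T t where T: "T \<subseteq> B" "card T = r" "\<forall>y\<in>T. t \<le> q y" "\<forall>y\<in>B - T. q y \<le> t"
    using ex_top_subset[OF cons.prems(2) r(2)] by metis
  \<comment> \<open>On \<open>S\<close> \<times> \<open>T\<close> the form \<open>p x + q y\<close>
    is at least \<open>s + t\<close>, on the product of the remainders at most \<open>s + t\<close>;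
    the sign of \<open>s + t\<close> decides which rectangle to use.\<close>
  show ?case
  proof (cases "s + t > 0")
    case True
    have "L (J x y)" if "x \<in> S" "y \<in> T" for x y
      using S T pq True that by (smt (verit) subsetD)
    then have "\<forall>x\<in>S. \<forall>y\<in>T. decision_list_value (d # D) (J x y) = a"
      using val S T by (auto simp: subset_iff)
    then show ?thesis using S T by blast
  next
    case False
    have nL: "\<not> L (J x y)" if "x \<in> A - S" "y \<in> B - T" for x y
      using S T pq False that by (smt (verit) Diff_iff)
    have "\<exists>A' B' v. A' \<subseteq> A - S \<and> B' \<subseteq> B - T \<and> card A' = r \<and> card B' = r \<and>
      (\<forall>x\<in>A'. \<forall>y\<in>B'. decision_list_value D (J x y) = v)"
    proof (rule cons.IH)
      show "length D * r \<le> card (A - S)" "length D * r \<le> card (B - T)"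
        using cons.prems(1-4) S(1,2) T(1,2) by (simp_all add: card_Diff_subset finite_subset)
      show "\<exists>(p :: 'a \<Rightarrow> real) q. \<forall>x\<in>A - S. \<forall>y\<in>B - T. L' (J x y) \<longleftrightarrow> p x + q y > 0"
        if "(L', a') \<in> set D" for L' a'
      proof -
        obtain p' :: "'a \<Rightarrow> real" and q' where "\<forall>x\<in>A. \<forall>y\<in>B. L' (J x y) \<longleftrightarrow> p' x + q' y > 0"
          using cons.prems(5)[OF list.set_intros(2)[OF \<open>(L', a') \<in> set D\<close>]] by blast
        then show ?thesis
          by (intro exI[of _ p'] exI[of _ q']) blast
      qed
      show "fst (last D) (J x y)" if "x \<in> A - S" "y \<in> B - T" for x y
        using cons.prems(6)[of x y] cons.hyps that by auto
    qed (use cons.prems(1,2) in auto)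
    then obtain A' B' v where "A' \<subseteq> A - S" "B' \<subseteq> B - T" "card A' = r" "card B' = r"
        and "\<forall>x\<in>A'. \<forall>y\<in>B'. decision_list_value D (J x y) = v"
      by blast
    moreover from this have "\<forall>x\<in>A'. \<forall>y\<in>B'. decision_list_value (d # D) (J x y) = v"
      using val nL by (metis DiffD1 subsetD)
    ultimately show ?thesis by blast
  qed
qed

section \<open>Majority of XOR\<close>

text \<open>Inverse to the splitting in \<open>as_joint_function\<close>; the restriction makes the
  result extensional, as \<open>bool_cube (2 * n)\<close> demands.\<close>

definition join_cube :: "nat \<Rightarrow> (nat \<Rightarrow> bool) \<Rightarrow> (nat \<Rightarrow> bool) \<Rightarrow> nat \<Rightarrow> bool" where
  "join_cube n x y = (\<lambda>i\<in>{1..2*n}. if i \<le> n then x i else y (i - n))"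

lemma join_cube_in_bool_cube: "join_cube n x y \<in> bool_cube (2 * n)"
  by (simp add: join_cube_def bool_cube_def)

text \<open>The weighted sum splits at \<open>n\<close>; the constant \<open>w0\<close> is put into
  \<open>p\<close>.\<close>

lemma is_LTF_join_cube:
  assumes "is_LTF (2 * n) L"
  shows "\<exists>p q. \<forall>x y. L (join_cube n x y) \<longleftrightarrow> p x + q y > (0::real)"
proof -
  obtain w0 and w :: "nat \<Rightarrow> real" where
    w: "\<forall>z\<in>bool_cube (2 * n). L z = bsign (w0 + (\<Sum>i=1..2*n. w i * of_bool (z i)))"
    using assms unfolding is_LTF_def by blast
  let ?p = "\<lambda>x. w0 + (\<Sum>i=1..n. w i * of_bool (x i))"
  let ?q = "\<lambda>y. \<Sum>i=1..n. w (n + i) * of_bool (y i)"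
  have "L (join_cube n x y) \<longleftrightarrow> ?p x + ?q y > 0" for x y
  proof -
    have L: "L (join_cube n x y) \<longleftrightarrow>
        w0 + (\<Sum>i=1..2*n. w i * of_bool (join_cube n x y i)) > 0"
      using w join_cube_in_bool_cube by (simp only: bsign_def)
    have "(\<Sum>i=1..2*n. w i * of_bool (join_cube n x y i)) =
        (\<Sum>i=1..n. w i * of_bool (join_cube n x y i)) +
        (\<Sum>i=n+1..n+n. w i * of_bool (join_cube n x y i))"
      using sum.ub_add_nat[of 1 n "\<lambda>i. w i * of_bool (join_cube n x y i)" n]
      by (simp add: mult_2)
    also have "(\<Sum>i=1..n. w i * of_bool (join_cube n x y i)) = (\<Sum>i=1..n. w i * of_bool (x i))"
      by (intro sum.cong) (auto simp: join_cube_def)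
    also have "(\<Sum>i=n+1..n+n. w i * of_bool (join_cube n x y i)) = ?q y"
      by (rule sum.reindex_bij_witness[of _ "\<lambda>i. n + i" "\<lambda>i. i - n"]) (auto simp: join_cube_def)
    finally show ?thesis
      unfolding L by (simp add: add.assoc)
  qed
  then show ?thesis
    by (intro exI[of _ ?p] exI[of _ ?q]) blast
qed

text \<open>The XOR bits sum to the Hamming distance. A tie, at distance exactly
  \<open>n / 2\<close>, gives \<open>False\<close> because \<open>bsign\<close> is strict.\<close>

lemma joint_MAJ_XOR_iff:
  "as_joint_function n (comp_XOR n (MAJ n)) (join_cube n x y) \<longleftrightarrow>
    n < 2 * hamming_dist {1..n} x y"
proof -
  let ?X = "\<lambda>i\<in>{1..n}. join_cube n x y i" and ?Y = "\<lambda>i\<in>{1..n}. join_cube n x y (n + i)"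
  have "(\<Sum>i=1..n. of_bool ((\<lambda>i\<in>{1..n}. ?X i \<noteq> ?Y i) i) :: real) =
      (\<Sum>i\<in>{1..n}. of_bool (x i \<noteq> y i))"
    by (intro sum.cong) (auto simp: join_cube_def)
  also have "\<dots> = hamming_dist {1..n} x y"
    by (simp add: hamming_dist_def Int_def)
  finally show ?thesis
    by (simp add: as_joint_function_def comp_XOR_def MAJ_def bsign_def del: restrict_apply) linarith
qed

definition compl_cube :: "nat \<Rightarrow> (nat \<Rightarrow> bool) \<Rightarrow> nat \<Rightarrow> bool" where
  "compl_cube n y = (\<lambda>i\<in>{1..n}. \<not> y i)"

lemma compl_cube_compl_cube: "y \<in> bool_cube n \<Longrightarrow> compl_cube n (compl_cube n y) = y"
  by (auto simp: compl_cube_def bool_cube_def fun_eq_iff PiE_def extensional_def)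

lemma hamming_dist_compl_cube:
  "hamming_dist {1..n} x (compl_cube n y) + hamming_dist {1..n} x y = n"
proof -
  let ?S = "{i\<in>{1..n}. x i \<noteq> y i}"
  have "{i\<in>{1..n}. x i \<noteq> compl_cube n y i} = {1..n} - ?S"
    by (auto simp: compl_cube_def)
  moreover have "card {1..n} = card ({1..n} \<inter> ?S) + card ({1..n} - ?S)"
    by (rule card_Int_Diff) simp
  moreover have "{1..n} \<inter> ?S = ?S"
    by blast
  ultimately show ?thesis
    unfolding hamming_dist_def by (simp only: card_atLeastAtMost)
qed

text \<open>For value \<open>True\<close> the sides are already far apart. For \<open>False\<close>
  all distances are at most \<open>n / 2\<close>, and complementing \<open>B\<close> keeps its size
  and makes them at least \<open>n / 2\<close>; ties fit the non-strict distance condition.\<close>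

lemma MAJ_XOR_monochromatic_rectangle_small:
  assumes A: "A \<subseteq> bool_cube n" and B: "B \<subseteq> bool_cube n"
    and mono: "\<forall>x\<in>A. \<forall>y\<in>B. as_joint_function n (comp_XOR n (MAJ n)) (join_cube n x y) = v"
  shows "real (card A) * real (card B) \<le> (25/8) ^ n"
proof (cases v)
  case True
  then show ?thesis
    using card_mult_card_le_of_distant[of "{1..n}" A B] A B mono
    by (auto simp: joint_MAJ_XOR_iff bool_cube_def less_imp_le)
next
  case False
  let ?B = "compl_cube n ` B"
  have "inj_on (compl_cube n) B"
    using B by (intro inj_on_inverseI[of _ "compl_cube n"]) (auto simp: compl_cube_compl_cube)
  then have "card ?B = card B"
    by (rule card_image)
  moreover have "n \<le> 2 * hamming_dist {1..n} x y" if "x \<in> A" "y \<in> ?B" for x y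
  proof -
    obtain y' where y': "y' \<in> B" "y = compl_cube n y'"
      using \<open>y \<in> ?B\<close> by blast
    then have "2 * hamming_dist {1..n} x y' \<le> n"
      using mono \<open>x \<in> A\<close> False by (simp add: joint_MAJ_XOR_iff not_less)
    then show ?thesis
      using hamming_dist_compl_cube[of n x y'] y' by simp
  qed
  moreover have "?B \<subseteq> {1..n} \<rightarrow>\<^sub>E UNIV"
    by (auto simp: compl_cube_def)
  ultimately show ?thesis
    using card_mult_card_le_of_distant[of "{1..n}" A ?B] A by (simp add: bool_cube_def)
qed

section \<open>The lower bound on the length\<close>

lemma linear_decision_list_MAJ_XOR_length:
  assumes D: "is_linear_decision_list (2 * n) D"
    and comp: "decision_list_computes (2 * n) D (as_joint_function n (comp_XOR n (MAJ n)))"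
  shows "(32/25) ^ n \<le> 4 * real (length D) ^ 2"
proof -
  define k r where "k = length D" and "r = 2 ^ n div k"
  let ?C = "bool_cube n"
  have C: "finite ?C" "card ?C = 2 ^ n"
    by (auto simp: bool_cube_def card_PiE intro: finite_PiE)
  have "D \<noteq> []"
    using D by (simp add: is_linear_decision_list_def)
  then have k: "k > 0" by (simp add: k_def)
  have "\<exists>A B v. A \<subseteq> ?C \<and> B \<subseteq> ?C \<and> card A = r \<and> card B = r \<and>
      (\<forall>x\<in>A. \<forall>y\<in>B. decision_list_value D (join_cube n x y) = v)"
  proof (rule decision_list_monochromatic_rectangle[OF \<open>D \<noteq> []\<close> C(1) C(1)])
    show "length D * r \<le> card ?C" "length D * r \<le> card ?C"
      by (simp_all add: C r_def k_def)
    show "\<exists>(p :: (nat \<Rightarrow> bool) \<Rightarrow> real) q. \<forall>x\<in>?C. \<forall>y\<in>?C. L (join_cube n x y) \<longleftrightarrow> p x + q y > 0"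
      if "(L, a) \<in> set D" for L a
    proof -
      have "is_LTF (2 * n) L"
        using D that by (auto simp: is_linear_decision_list_def)
      from is_LTF_join_cube[OF this] show ?thesis by metis
    qed
    show "fst (last D) (join_cube n x y)" for x y
      using D join_cube_in_bool_cube by (simp add: is_linear_decision_list_def)
  qed
  then obtain A B v where AB: "A \<subseteq> ?C" "B \<subseteq> ?C" "card A = r" "card B = r"
      and "\<forall>x\<in>A. \<forall>y\<in>B. decision_list_value D (join_cube n x y) = v"
    by blast
  then have "\<forall>x\<in>A. \<forall>y\<in>B. as_joint_function n (comp_XOR n (MAJ n)) (join_cube n x y) = v"
    using comp join_cube_in_bool_cube by (simp add: decision_list_computes_def)
  from MAJ_XOR_monochromatic_rectangle_small[OF AB(1,2) this]
  have r: "real r ^ 2 \<le> (25/8) ^ n"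
    by (simp add: AB power2_eq_square)
  \<comment> \<open>Undoes the rounding in \<open>r\<close>. The \<open>max\<close> covers
    \<open>r = 0\<close>, where \<open>k\<close> exceeds \<open>2 ^ n\<close>; it is harmless below
    because \<open>(25/8) ^ n\<close> is at least 1.\<close>
  have "2 ^ n \<le> 2 * real k * max 1 (real r)"
  proof -
    have "2 ^ n = k * r + 2 ^ n mod k" "2 ^ n mod k < k"
      using k by (simp_all add: r_def)
    then have "2 ^ n \<le> k * r + k" by simp
    also have "\<dots> \<le> 2 * k * max 1 r"
      by (cases "r \<ge> 1") (auto simp: max_def)
    finally have "real (2 ^ n) \<le> real (2 * k * max 1 r)"
      by (rule of_nat_mono)
    then show ?thesis by simp
  qed
  then have "(2 ^ n)\<^sup>2 \<le> (2 * real k * max 1 (real r))\<^sup>2"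
    by (intro power_mono) auto
  also have "\<dots> = 4 * real k ^ 2 * max 1 (real r) ^ 2"
    by (simp add: power_mult_distrib)
  also have "max 1 (real r) ^ 2 \<le> (25/8) ^ n"
    using r by (auto simp: max_def)
  \<comment> \<open>The base is 4, factored so that \<open>(25/8) ^ n\<close> cancels.\<close>
  finally have "(32/25 * (25/8)) ^ n \<le> 4 * real k ^ 2 * (25/8) ^ n"
    by (simp add: mult_left_mono power2_eq_square flip: power_mult_distrib)
  then show ?thesis
    unfolding power_mult_distrib by (simp add: k_def)
qed

theorem theorem1:
  shows "\<exists>c::real. c > 0 \<and> (\<exists>n0::nat. \<forall>n\<ge>n0. \<forall>D.
    is_linear_decision_list (2 * n) D \<longrightarrow>
    decision_list_computes (2 * n) D (as_joint_function n (comp_XOR n (MAJ n))) \<longrightarrow>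
    real (length D) \<ge> 2 powr (c * real n))"
proof (intro exI[of _ "1/12"] exI[of _ "12"] conjI allI impI)
  fix n :: nat and D
  assume n: "12 \<le> n" and D: "is_linear_decision_list (2 * n) D"
    "decision_list_computes (2 * n) D (as_joint_function n (comp_XOR n (MAJ n)))"
  \<comment> \<open>The cube of 32/25 slightly exceeds 2, which gives the rate
    \<open>n / 3\<close>.\<close>
  have "2 powr (n / 3) \<le> ((32/25 :: real) ^ 3) powr (n / 3)"
    by (intro powr_mono2) (auto simp: power3_eq_cube)
  also have "(32/25 :: real) ^ 3 = (32/25) powr real 3"
    by (rule powr_realpow[symmetric]) simp
  also have "((32/25 :: real) powr real 3) powr (n / 3) = (32/25) powr real n"
    by (simp only: powr_powr) simp
  also have "\<dots> = (32/25) ^ n"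
    by (rule powr_realpow) simp
  finally have "2 powr (n / 3) \<le> 4 * real (length D) ^ 2"
    using linear_decision_list_MAJ_XOR_length[OF D] by linarith
  moreover have "4 * 2 powr (n / 6) = (2::real) powr (2 + n / 6)"
    by (simp add: powr_add)
  \<comment> \<open>Half of the exponent \<open>n / 3\<close> absorbs the factor 4 once
    \<open>n\<close> is at least 12; the square root of the other half gives
    \<open>c = 1/12\<close>.\<close>
  moreover have "(2::real) powr (2 + n / 6) \<le> 2 powr (n / 3)"
    using n by (intro powr_mono) auto
  moreover have "2 powr (n / 6) = (2 powr (1/12 * real n) :: real) ^ 2"
    by (simp add: power2_eq_square flip: powr_add)
  ultimately have "(2 powr (1/12 * real n)) ^ 2 \<le> real (length D) ^ 2"
    by linarith
  then show "2 powr (1/12 * real n) \<le> real (length D)"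
    by (rule power2_le_imp_le) simp
qed simp

end
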